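(* Let $n\ge 6$ and let $Q\subseteq\mathbb{R}^d$, with linear map $p$, be a weakly symmetric subspace extension of the permutahedron $\Pi_n$ with $d<\frac{n(n-1)}{2}$, with respect to $G=S_n$, and let $s=(s_1,\dots,s_d):X\to Q$ be a section as in the definition of weak symmetry. Then there exists a partition of $\{1,\dots,d\}$ into sets $\mathcal{A}_i$ and $\mathcal{B}_j$ such that each $\mathcal{B}_j$ consists of a single element $b_j$ and each $\mathcal{A}_i$ consists of $n$ elements $a^i_1,a^i_2,\dots,a^i_n$, with $$s_{a^i_t}(\pi.x)=s_{a^i_{\pi^{-1}(t)}}(x)\qquad\text{and}\qquad s_{b_j}(\pi.x)=s_{b_j}(x)$$ for every vertex $x\in X$, every $t\in\{1,\dots,n\}$, all $i,j$, and all $\pi\in A_n$.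
   Context: $\Pi_n$ is the convex hull of all coordinate permutations of $(1,2,\dots,n)$, with vertex set $X=\{(\zeta^{-1}(1),\dots,\zeta^{-1}(n)):\zeta\in S_n\}$. $S_n$ acts on $\mathbb{R}^n$ by $(\pi.x)_v=x_{\pi^{-1}(v)}$ and $S_d$ acts on $\mathbb{R}^d$ by $(\varkappa.y)_j=y_{\varkappa^{-1}(j)}$. A subspace extension of $\Pi_n$ is a set $Q\subseteq\mathbb{R}^d$ that is the intersection of an affine subspace with $\mathbb{R}^d_+$, together with a linear map $p:\mathbb{R}^d\to\mathbb{R}^n$ with $p(Q)=\Pi_n$. A section is a map $s:X\to Q$ with $p(s(x))=x$; the extension is weakly symmetric if there is a section $s$ such that for each $\pi\in S_n$ there is $\varkappa_\pi\in S_d$ with $s(\pi.x)=\varkappa_\pi.s(x)$ for all $x\in X$. $A_n$ denotes the alternating group on $\{1,\dots,n\}$. *)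

theory Defs
  imports "HOL-Analysis.Analysis" "HOL-Combinatorics.Permutations"
begin

text \<open>R^n is modelled as real^'n with n = CARD('n); the coordinate index type 'n
  plays the role of {1..n}. Likewise R^d is real^'d with d = CARD('d).\<close>

definition perm_act :: "('i::finite \<Rightarrow> 'i) \<Rightarrow> real^'i \<Rightarrow> real^'i" where
  "perm_act \<pi> x = (\<chi> v. x $ (inv \<pi> v))"

text \<open>Vertex set of the permutahedron: vectors whose coordinates are a permutation
  of 1,...,n (i.e. (zeta^-1(1),...,zeta^-1(n)) for zeta in S_n).\<close>
definition perm_vertices :: "(real^'n::finite) set" where
  "perm_vertices = {x. \<exists>f. bij_betw f (UNIV::'n set) {1..CARD('n)} \<and> (\<forall>v. x $ v = real (f v))}"

definition permutahedron :: "(real^'n::finite) set" where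
  "permutahedron = convex hull perm_vertices"

definition subspace_extension :: "(real^'d::finite) set \<Rightarrow> (real^'d \<Rightarrow> real^'n::finite) \<Rightarrow> bool" where
  "subspace_extension Q p \<longleftrightarrow>
     (\<exists>A. affine A \<and> Q = A \<inter> {y. \<forall>i. 0 \<le> y $ i}) \<and> linear p \<and> p ` Q = permutahedron"

definition weakly_symmetric_section ::
  "(real^'d::finite) set \<Rightarrow> (real^'d \<Rightarrow> real^'n::finite) \<Rightarrow> (real^'n \<Rightarrow> real^'d) \<Rightarrow> bool" where
  "weakly_symmetric_section Q p s \<longleftrightarrow>
     (\<forall>x\<in>perm_vertices. s x \<in> Q \<and> p (s x) = x) \<and>
     (\<forall>\<pi>. \<pi> permutes (UNIV::'n set) \<longrightarrow>
        (\<exists>\<kappa>. \<kappa> permutes (UNIV::'d set) \<and>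
           (\<forall>x\<in>perm_vertices. s (perm_act \<pi> x) = perm_act \<kappa> (s x))))"

end

theory Submission
  imports Defs "HOL-Library.Function_Algebras" "HOL-Library.Ramsey"
begin

text \<open>
  The partition exists because the hypotheses are contradictory: every weakly symmetric extension
  has \<open>2 d \<ge> n (n - 1)\<close>. Group theory alone would not give the partition for \<open>n = 6\<close>, since
  \<open>S\<^sub>6\<close> has transitive subgroups of index 6.

  Regard the coordinates of the section as functions \<open>g\<close> on the bijections \<open>V \<rightarrow> {1..n}\<close>, which the
  symmetric group permutes. For every \<open>1 \<le> j < n\<close> some \<open>g\<close> must vanish on the facet of a \<open>j\<close>-set
  \<open>S\<close>, but not on some vertex next to it. A single orbit \<open>O\<close> of coordinates serves at most
  \<open>2 |O| / n\<close> of these \<open>j\<close>, unless already \<open>2 |O| \<ge> n (n - 1)\<close>.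

  Such a \<open>j\<close> forces the stabilizer \<open>U\<close> of \<open>g\<close> to be intransitive on \<open>j\<close>-subsets. If \<open>U\<close> is
  transitive on \<open>i\<close>-subsets for \<open>i < j\<close> but not for \<open>i = j\<close>, the permutation module of \<open>O\<close> contains
  the Specht module of shape \<open>(n - j, j)\<close>, so \<open>|O| \<ge> (n choose j) - (n choose (j - 1))\<close>, which
  suffices for \<open>j \<ge> 2\<close>. If \<open>U\<close> is intransitive on points, then either \<open>|O| \<ge> (n choose 2)\<close>, or \<open>U\<close>
  fixes a point \<open>v\<close>; in the latter case the same dimension bound on \<open>V - {v}\<close> lets us assume that
  \<open>U\<close> is transitive on the \<open>i\<close>-subsets of \<open>V - {v}\<close> for all \<open>i\<close>. Then \<open>j + 1\<close> is the smallest or \<open>j\<close>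
  is the largest label of \<open>v\<close> on the support of \<open>g\<close>, so there are at most two such \<open>j\<close>, while
  \<open>|O| \<ge> n\<close>.
\<close>

section \<open>Underdetermined linear systems\<close>

lemma sum_fun_apply: "(\<Sum>i\<in>A. f i) x = (\<Sum>i\<in>A. f i x)"
  by (induction A rule: infinite_finite_induct) auto

interpretation function_space: vector_space "\<lambda>(c::'f::field) (f::'b \<Rightarrow> 'f) b. c * f b"
  by unfold_locales (auto simp: fun_eq_iff algebra_simps)

lemma card_independent_functions_le_card_support:
  fixes F :: "('b \<Rightarrow> 'f::field) set"
  assumes "finite B" "function_space.independent F" "\<And>f b. f \<in> F \<Longrightarrow> b \<notin> B \<Longrightarrow> f b = 0"
  shows "card F \<le> card B"
proof -
  define unit :: "'b \<Rightarrow> 'b \<Rightarrow> 'f" where "unit = (\<lambda>b b'. of_bool (b' = b))"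
  have "f \<in> function_space.span (unit ` B)" if "f \<in> F" for f
  proof -
    have "f = (\<Sum>b\<in>B. (\<lambda>b'. f b * unit b b'))"
      using assms(3)[OF that] \<open>finite B\<close>
      by (auto simp: fun_eq_iff unit_def sum_fun_apply Int_insert_right)
    also have "\<dots> \<in> function_space.span (unit ` B)"
      by (intro function_space.span_sum function_space.span_scale function_space.span_base) auto
    finally show ?thesis .
  qed
  then have "card F \<le> card (unit ` B)"
    using function_space.independent_span_bound[of "unit ` B" F] assms(1,2) by blast
  also have "\<dots> \<le> card B" using \<open>finite B\<close> by (rule card_image_le)
  finally show ?thesis .
qed

lemma underdetermined_system_has_nontrivial_solution:
  fixes M :: "'b \<Rightarrow> 'a \<Rightarrow> 'f::field"
  assumes "finite A" "finite B" "card B < card A"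
  obtains w where "\<exists>a\<in>A. w a \<noteq> 0" "\<forall>b\<in>B. (\<Sum>a\<in>A. M b a * w a) = 0"
proof -
  define column where "column = (\<lambda>a b. if b \<in> B then M b a else 0)"
  have "card (column ` A) < card A" if "function_space.independent (column ` A)"
    using card_independent_functions_le_card_support[OF assms(2) that] assms(3)
    by (fastforce simp: column_def)
  then consider (collision) "\<not> inj_on column A"
    | (relation) "inj_on column A" "function_space.dependent (column ` A)"
    using card_image[of column A] by fastforce
  then show thesis
  proof cases
    case collision
    then obtain a a' where a: "a \<in> A" "a' \<in> A" "a \<noteq> a'" "column a = column a'"
      by (auto simp: inj_on_def)
    let ?w = "\<lambda>x. of_bool (x = a) - of_bool (x = a') :: 'f"
    have "M b a = M b a'" if "b \<in> B" for b
      using fun_cong[OF a(4), of b] that by (simp add: column_def)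
    then have "\<forall>b\<in>B. (\<Sum>x\<in>A. M b x * ?w x) = 0"
      using a \<open>finite A\<close> by (simp add: right_diff_distrib sum_subtractf)
    with a show thesis by (intro that[of ?w]) auto
  next
    case relation
    then obtain u where u: "\<exists>v\<in>column ` A. u v \<noteq> 0"
      "(\<Sum>v\<in>column ` A. (\<lambda>b. u v * v b)) = 0"
      using function_space.dependent_finite[of "column ` A"] \<open>finite A\<close> by auto
    have "(\<Sum>a\<in>A. M b a * u (column a)) = 0" if "b \<in> B" for b
    proof -
      have "(\<Sum>a\<in>A. M b a * u (column a)) = (\<Sum>a\<in>A. u (column a) * column a b)"
        using that by (simp add: column_def mult.commute)
      also have "\<dots> = (\<Sum>v\<in>column ` A. u v * v b)"
        by (simp add: sum.reindex[OF relation(1)])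
      also have "\<dots> = 0"
        using fun_cong[OF u(2), of b] by (simp add: sum_fun_apply)
      finally show ?thesis .
    qed
    with u(1) show thesis by (intro that[of "u \<circ> column"]) auto
  qed
qed

section \<open>Permutations and subsets of fixed size\<close>

lemma inj_on_extends_to_permutation:
  assumes "finite V" "S \<subseteq> V" "inj_on f S" "f ` S \<subseteq> V"
  obtains \<pi> where "\<pi> permutes V" "\<forall>x\<in>S. \<pi> x = f x"
proof -
  have "card (V - S) = card (V - f ` S)"
    using assms by (simp add: card_Diff_subset card_image finite_subset[of _ V])
  then obtain g where g: "bij_betw g (V - S) (V - f ` S)"
    using finite_same_card_bij[of "V - S" "V - f ` S"] \<open>finite V\<close> by blast
  define \<pi> where "\<pi> = (\<lambda>x. if x \<in> S then f x else if x \<in> V then g x else x)"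
  have "bij_betw \<pi> S (f ` S)"
    using \<open>inj_on f S\<close> by (auto simp: \<pi>_def bij_betw_def inj_on_def)
  moreover have "bij_betw \<pi> (V - S) (V - f ` S)"
    using g by (rule bij_betw_cong[THEN iffD1, rotated]) (auto simp: \<pi>_def)
  ultimately have "bij_betw \<pi> (S \<union> (V - S)) (f ` S \<union> (V - f ` S))"
    by (rule bij_betw_combine) auto
  then have "bij_betw \<pi> V V"
    using assms(2,4) by (simp add: Un_absorb1)
  then have "\<pi> permutes V"
    using \<open>S \<subseteq> V\<close> by (intro bij_imp_permutes) (auto simp: \<pi>_def)
  then show thesis by (rule that) (simp add: \<pi>_def)
qed

lemma permutation_between_nsets:
  assumes "finite V" "S \<in> nsets V k" "S' \<in> nsets V k"
  obtains \<pi> where "\<pi> permutes V" "\<pi> ` S = S'"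
proof -
  obtain f where f: "bij_betw f S S'"
    using assms(2,3) finite_same_card_bij[of S S'] by (auto simp: nsets_def)
  then obtain \<pi> where "\<pi> permutes V" "\<forall>x\<in>S. \<pi> x = f x"
    using assms inj_on_extends_to_permutation[of V S f] by (auto simp: nsets_def bij_betw_def)
  with f show thesis by (intro that[of \<pi>]) (auto simp: bij_betw_def)
qed

lemma permutation_between_pairs:
  assumes "finite V" "a \<in> V" "b \<in> V" "a \<noteq> b" "c \<in> V" "d \<in> V" "c \<noteq> d"
  obtains \<pi> where "\<pi> permutes V" "\<pi> a = c" "\<pi> b = d"
proof -
  let ?f = "\<lambda>x. if x = a then c else d"
  have "{a, b} \<subseteq> V" "inj_on ?f {a, b}" "?f ` {a, b} \<subseteq> V"
    using assms by (auto simp: inj_on_def)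
  then obtain \<pi> where "\<pi> permutes V" "\<forall>x\<in>{a, b}. \<pi> x = ?f x"
    by (rule inj_on_extends_to_permutation[OF \<open>finite V\<close>])
  with \<open>a \<noteq> b\<close> show thesis by (intro that[of \<pi>]) simp_all
qed

lemma image_inv_image_permutes [simp]: "\<pi> permutes V \<Longrightarrow> inv \<pi> ` \<pi> ` T = T"
  by (simp add: image_image permutes_inverses)

lemma image_image_inv_permutes [simp]: "\<pi> permutes V \<Longrightarrow> \<pi> ` inv \<pi> ` T = T"
  by (simp add: image_image permutes_inverses)

lemma permutes_image_Diff: "\<pi> permutes V \<Longrightarrow> \<pi> ` (V - S) = V - \<pi> ` S"
  by (simp add: image_set_diff permutes_inj permutes_image)

lemma image_in_nsets_iff:
  assumes "\<pi> permutes V"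
  shows "\<pi> ` T \<in> nsets V k \<longleftrightarrow> T \<in> nsets V k"
proof -
  have "\<sigma> ` T \<in> nsets V k" if "\<sigma> permutes V" "T \<in> nsets V k" for \<sigma> T
    using bij_betw_nsets[OF permutes_imp_bij[OF that(1)]] that(2) by (rule bij_betwE[rule_format])
  from this[OF assms] this[OF permutes_inv[OF assms], of "\<pi> ` T"] show ?thesis
    using assms by auto
qed

lemma insert_in_nsets:
  "R \<in> nsets V k \<Longrightarrow> z \<in> V - R \<Longrightarrow> insert z R \<in> nsets V (Suc k)"
  by (auto simp: nsets_def)

lemma nsets_SucE:
  assumes "T \<in> nsets V (Suc k)"
  obtains z R where "R \<in> nsets V k" "z \<in> V - R" "T = insert z R"
  using assms by (auto simp: nsets_def card_Suc_eq)

lemma sum_nsets_superset: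
  assumes "finite V" "R \<in> nsets V k"
  shows "(\<Sum>T\<in>nsets V (Suc k). of_bool (R \<subseteq> T) * f T) = (\<Sum>z\<in>V - R. f (insert z R) :: 'f::semiring_1)"
proof -
  have "T \<in> (\<lambda>z. insert z R) ` (V - R)" if "T \<in> nsets V (Suc k)" "R \<subseteq> T" for T
  proof -
    have "card (T - R) = 1"
      using that assms by (auto simp: nsets_def card_Diff_subset)
    then obtain z where "T - R = {z}" by (rule card_1_singletonE)
    with that show ?thesis by (auto simp: nsets_def)
  qed
  then have "(\<lambda>z. insert z R) ` (V - R) = {T \<in> nsets V (Suc k). R \<subseteq> T}"
    using insert_in_nsets[OF assms(2)] by auto
  moreover have "inj_on (\<lambda>z. insert z R) (V - R)" by (auto simp: inj_on_def)
  ultimately have "(\<Sum>z\<in>V - R. f (insert z R)) = (\<Sum>T | T \<in> nsets V (Suc k) \<and> R \<subseteq> T. f T)"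
    using sum.reindex[of "\<lambda>z. insert z R" "V - R" f] by simp
  also have "\<dots> = (\<Sum>T\<in>nsets V (Suc k). of_bool (R \<subseteq> T) * f T)"
    using finite_imp_finite_nsets[OF \<open>finite V\<close>] by (intro sum.mono_neutral_cong_left) auto
  finally show ?thesis by (rule sym)
qed

section \<open>Harmonic functions on subsets\<close>

text \<open>The harmonic functions on the \<open>k\<close>-subsets form the Specht module of shape \<open>(n - k, k)\<close>.\<close>

primrec harmonic :: "'a set \<Rightarrow> nat \<Rightarrow> ('a set \<Rightarrow> 'f::field_char_0) \<Rightarrow> bool" where
  "harmonic V 0 w \<longleftrightarrow> True"
| "harmonic V (Suc k) w \<longleftrightarrow> (\<forall>R\<in>nsets V k. (\<Sum>z\<in>V - R. w (insert z R)) = 0)"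

lemma harmonic_permute:
  assumes "\<pi> permutes V" "harmonic V k w"
  shows "harmonic V k (\<lambda>T. w (\<pi> ` T))"
proof (cases k)
  case (Suc j)
  have "(\<Sum>z\<in>V - R. w (\<pi> ` insert z R)) = 0" if "R \<in> nsets V j" for R
  proof -
    have "(\<Sum>z\<in>V - R. w (\<pi> ` insert z R)) = (\<Sum>z\<in>\<pi> ` (V - R). w (insert z (\<pi> ` R)))"
      using assms(1) by (simp add: sum.reindex permutes_inj_on)
    also have "\<dots> = 0"
      using assms that Suc by (simp add: permutes_image_Diff image_in_nsets_iff)
    finally show ?thesis .
  qed
  then show ?thesis by (simp add: Suc)
qed simp

definition exchange :: "'a \<Rightarrow> 'a \<Rightarrow> ('a set \<Rightarrow> 'f::field_char_0) \<Rightarrow> 'a set \<Rightarrow> 'f" where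
  "exchange a b w R = w (insert a R) - w (insert b R)"

lemma harmonic_exchange:
  assumes "finite V" "harmonic V (Suc k) w" "a \<in> V" "b \<in> V" "a \<noteq> b"
  shows "harmonic (V - {a, b}) k (exchange a b w)"
proof (cases k)
  case (Suc j)
  have "(\<Sum>z\<in>V - {a, b} - R. exchange a b w (insert z R)) = 0" if R: "R \<in> nsets (V - {a, b}) j" for R
  proof -
    have sum_insert: "(\<Sum>z\<in>V - {a, b} - R. w (insert c (insert z R))) = - w (insert a (insert b R))"
      if c: "c \<in> V" "c' \<in> V" "c \<noteq> c'" "{c, c'} = {a, b}" for c c'
    proof -
      have notin: "c \<notin> R" "c' \<notin> R" using R that(4) by (auto simp: nsets_def)
      then have "V - insert c R = insert c' (V - {a, b} - R)"
        using c by auto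
      moreover have "insert c R \<in> nsets V k"
        using R c(1) notin Suc by (auto simp: nsets_def)
      ultimately have "0 = (\<Sum>z\<in>insert c' (V - {a, b} - R). w (insert z (insert c R)))"
        using assms(2) by fastforce
      also have "\<dots> = w (insert c' (insert c R)) + (\<Sum>z\<in>V - {a, b} - R. w (insert z (insert c R)))"
        using c(4) \<open>finite V\<close> by (subst sum.insert) auto
      also have "insert c' (insert c R) = insert a (insert b R)" using c(4) by blast
      finally show ?thesis by (simp add: insert_commute[of c] eq_neg_iff_add_eq_0 add.commute)
    qed
    from sum_insert[of a b] sum_insert[of b a] assms(3-5) show ?thesis
      by (simp add: exchange_def sum_subtractf insert_commute)
  qed
  then show ?thesis by (simp add: Suc)
qed simp

lemma harmonic_exchange_nonzero:
  assumes "finite V" "harmonic V (Suc k) w" "T \<in> nsets V (Suc k)" "w T \<noteq> 0"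
  obtains a b R where "a \<in> V" "b \<in> V" "a \<noteq> b" "R \<in> nsets (V - {a, b}) k" "exchange a b w R \<noteq> 0"
proof -
  obtain a R where R: "R \<in> nsets V k" "a \<in> V - R" "T = insert a R"
    using assms(3) by (rule nsets_SucE)
  have "\<exists>b\<in>V - R. w (insert b R) \<noteq> w T"
  proof (rule ccontr)
    assume "\<not> ?thesis"
    then have "(\<Sum>z\<in>V - R. w (insert z R)) = (\<Sum>z\<in>V - R. w T)"
      by (intro sum.cong) auto
    then have "card (V - R) = 0" using assms(2,4) R(1) by simp
    with \<open>finite V\<close> R(2) show False by auto
  qed
  then obtain b where "b \<in> V - R" "w (insert b R) \<noteq> w T" by blast
  with R show thesis
    by (intro that[of a b R]) (auto simp: nsets_def exchange_def)
qed

lemma harmonic_translate_exchange_nonzero: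
  assumes "finite V" "harmonic V (Suc k) w" "T \<in> nsets V (Suc k)" "w T \<noteq> 0"
    and "a \<in> V" "b \<in> V" "a \<noteq> b"
  obtains \<pi> R where "\<pi> permutes V" "R \<in> nsets (V - {a, b}) k"
    "exchange a b (\<lambda>T. w (\<pi> ` T)) R \<noteq> 0"
proof -
  obtain c d R where R: "c \<in> V" "d \<in> V" "c \<noteq> d" "R \<in> nsets (V - {c, d}) k" "exchange c d w R \<noteq> 0"
    using harmonic_exchange_nonzero[OF assms(1-4)] by metis
  obtain \<pi> where \<pi>: "\<pi> permutes V" "\<pi> a = c" "\<pi> b = d"
    using permutation_between_pairs[OF assms(1,5-7) R(1-3)] by blast
  have "bij_betw \<pi> (V - {a, b}) (V - {c, d})"
    using \<pi> by (auto simp: bij_betw_def permutes_inj_on permutes_image_Diff)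
  from bij_betw_imp_surj_on[OF bij_betw_nsets[OF this]] R(4)
  obtain R' where "R' \<in> nsets (V - {a, b}) k" "R = \<pi> ` R'"
    by blast
  with R(5) \<pi> show thesis by (intro that[of \<pi> R']) (auto simp: exchange_def)
qed

definition pairing :: "'a set \<Rightarrow> nat \<Rightarrow> ('a set \<Rightarrow> 'f::field_char_0) \<Rightarrow> ('a set \<Rightarrow> 'f) \<Rightarrow> 'f" where
  "pairing V k w u = (\<Sum>T\<in>nsets V k. w T * u T)"

lemma pairing_diff_left:
  "pairing V k (\<lambda>T. w T - w' T) u = pairing V k w u - pairing V k w' u"
  by (simp add: pairing_def left_diff_distrib sum_subtractf)

lemma sum_nsets_containing_one_of_two:
  assumes "a \<in> V" "b \<in> V" "a \<noteq> b"
  shows "(\<Sum>T | T \<in> nsets V (Suc k) \<and> a \<in> T \<and> b \<notin> T. f T) =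
    (\<Sum>R\<in>nsets (V - {a, b}) k. f (insert a R))"
  by (rule sum.reindex_bij_witness[of _ "insert a" "\<lambda>T. T - {a}"])
    (use assms in \<open>auto simp: nsets_def insert_absorb card_insert_if\<close>)

lemma pairing_exchange:
  assumes "finite V" "a \<in> V" "b \<in> V" "a \<noteq> b"
  shows "pairing V (Suc k) (\<lambda>T. w T - w (Transposition.transpose a b ` T)) u =
    pairing (V - {a, b}) k (exchange a b w) (exchange a b u)"
proof -
  let ?\<tau> = "Transposition.transpose a b" and ?N = "nsets V (Suc k)"
  let ?h = "\<lambda>T. (w T - w (?\<tau> ` T)) * u T"
  have swapped: "?\<tau> ` insert a R = insert b R" "?\<tau> ` insert b R = insert a R"
    if "R \<in> nsets (V - {a, b}) k" for R
  proof -
    have "?\<tau> ` R = R" using that by (intro transpose_image_eq) (auto simp: nsets_def)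
    then show "?\<tau> ` insert a R = insert b R" "?\<tau> ` insert b R = insert a R" by auto
  qed
  have "?h T = 0" if "a \<in> T \<longleftrightarrow> b \<in> T" for T
    using that by simp
  then have "pairing V (Suc k) (\<lambda>T. w T - w (?\<tau> ` T)) u =
      sum ?h ({T. T \<in> ?N \<and> a \<in> T \<and> b \<notin> T} \<union> {T. T \<in> ?N \<and> b \<in> T \<and> a \<notin> T})"
    unfolding pairing_def
    using finite_imp_finite_nsets[OF \<open>finite V\<close>] by (intro sum.mono_neutral_right) blast+
  also have "\<dots> = (\<Sum>R\<in>nsets (V - {a, b}) k. ?h (insert a R)) +
      (\<Sum>R\<in>nsets (V - {b, a}) k. ?h (insert b R))"
    using finite_imp_finite_nsets[OF \<open>finite V\<close>] assms
    by (subst sum.union_disjoint) (auto simp: sum_nsets_containing_one_of_two)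
  also have "\<dots> = (\<Sum>R\<in>nsets (V - {a, b}) k. ?h (insert a R) + ?h (insert b R))"
    by (simp only: sum.distrib insert_commute)
  also have "\<dots> = (\<Sum>R\<in>nsets (V - {a, b}) k. exchange a b w R * exchange a b u R)"
    by (intro sum.cong refl) (simp add: swapped exchange_def algebra_simps del: image_insert)
  finally show ?thesis by (simp add: pairing_def)
qed

text \<open>Irreducibility of the Specht module: passing to \<open>exchange a b\<close> lowers \<open>k\<close>, since it turns the
  pairing of \<open>(1 - (a b)) w\<close> with \<open>u\<close> into a pairing on \<open>V - {a, b}\<close>.\<close>

lemma harmonic_translate_pairing_nonzero:
  fixes w u :: "'a set \<Rightarrow> 'f::field_char_0"
  assumes "finite V" "harmonic V k w" "T \<in> nsets V k" "w T \<noteq> 0"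
    "harmonic V k u" "T' \<in> nsets V k" "u T' \<noteq> 0"
  shows "\<exists>\<pi>. \<pi> permutes V \<and> pairing V k (\<lambda>T. w (\<pi> ` T)) u \<noteq> 0"
  using assms
proof (induction k arbitrary: V w u T T')
  case 0
  then have "pairing V 0 (\<lambda>T. w (id ` T)) u \<noteq> 0" by (simp add: pairing_def)
  then show ?case using permutes_id by blast
next
  case (Suc k)
  obtain a b R' where ab: "a \<in> V" "b \<in> V" "a \<noteq> b" and R': "R' \<in> nsets (V - {a, b}) k"
    "exchange a b u R' \<noteq> 0"
    using harmonic_exchange_nonzero[OF Suc.prems(1,5-7)] by metis
  obtain \<tau> R where \<tau>: "\<tau> permutes V" and R: "R \<in> nsets (V - {a, b}) k"
    "exchange a b (\<lambda>T. w (\<tau> ` T)) R \<noteq> 0"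
    using harmonic_translate_exchange_nonzero[OF Suc.prems(1-4) ab] by metis
  obtain \<rho> where \<rho>: "\<rho> permutes V - {a, b}"
    "pairing (V - {a, b}) k (\<lambda>T. exchange a b (\<lambda>T. w (\<tau> ` T)) (\<rho> ` T)) (exchange a b u) \<noteq> 0"
    using Suc.IH[OF _ harmonic_exchange[OF Suc.prems(1) harmonic_permute[OF \<tau> Suc.prems(2)] ab] R
        harmonic_exchange[OF Suc.prems(1,5) ab] R'] Suc.prems(1) by auto
  define \<pi> where "\<pi> = \<tau> \<circ> \<rho>"
  have \<pi>: "\<pi> permutes V"
    using permutes_subset[OF \<rho>(1)] \<tau> by (auto simp: \<pi>_def intro: permutes_compose)
  have "\<rho> a = a" "\<rho> b = b" using \<rho>(1) by (auto simp: permutes_def)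
  then have "(\<lambda>T. exchange a b (\<lambda>T. w (\<tau> ` T)) (\<rho> ` T)) = exchange a b (\<lambda>T. w (\<pi> ` T))"
    by (simp add: exchange_def \<pi>_def image_comp fun_eq_iff)
  with \<rho>(2) have "pairing V (Suc k) (\<lambda>T. w (\<pi> ` T)) u \<noteq>
      pairing V (Suc k) (\<lambda>T. w (\<pi> ` Transposition.transpose a b ` T)) u"
    using pairing_exchange[OF Suc.prems(1) ab, of k "\<lambda>T. w (\<pi> ` T)" u]
    by (auto simp: pairing_diff_left)
  then consider "pairing V (Suc k) (\<lambda>T. w (\<pi> ` T)) u \<noteq> 0"
    | "pairing V (Suc k) (\<lambda>T. w ((\<pi> \<circ> Transposition.transpose a b) ` T)) u \<noteq> 0"
    by (fastforce simp: image_comp)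
  then show ?case
    using \<pi> permutes_compose[OF permutes_swap_id[OF ab(1,2)] \<pi>] by cases blast+
qed

definition translates :: "'a set \<Rightarrow> ('a set \<Rightarrow> 'f) \<Rightarrow> ('a set \<Rightarrow> 'f) set" where
  "translates V w = (\<lambda>\<pi> T. w (\<pi> ` T)) ` {\<pi>. \<pi> permutes V}"

text \<open>The translates of \<open>w\<close> span the Specht module, as no nonzero harmonic function is orthogonal to
  all of them.\<close>

lemma binomial_le_card_harmonic_translates:
  fixes w :: "'a set \<Rightarrow> 'f::field_char_0"
  assumes "finite V" "harmonic V (Suc k) w" "T \<in> nsets V (Suc k)" "w T \<noteq> 0"
  shows "card V choose Suc k \<le> (card V choose k) + card (translates V w)"
proof (rule ccontr)
  let ?N = "nsets V (Suc k)" and ?E = "nsets V k <+> translates V w"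
  let ?M = "case_sum (\<lambda>R T. of_bool (R \<subseteq> T)) (\<lambda>f. f)"
  assume "\<not> ?thesis"
  moreover have fin: "finite ?N" "finite (nsets V k)" "finite (translates V w)"
    using assms(1) by (auto simp: translates_def finite_imp_finite_nsets finite_permutations)
  ultimately have "finite ?E" "card ?E < card ?N" by (simp_all add: card_Plus)
  then obtain u where u: "\<exists>T\<in>?N. u T \<noteq> 0"
    "\<forall>e\<in>?E. (\<Sum>T\<in>?N. ?M e T * u T) = 0"
    by (rule underdetermined_system_has_nontrivial_solution[where M = ?M, OF fin(1)])
  have "(\<Sum>z\<in>V - R. u (insert z R)) = 0" if "R \<in> nsets V k" for R
    using bspec[OF u(2) InlI[OF that]] sum_nsets_superset[OF assms(1) that, of u] by simp
  then have "harmonic V (Suc k) u" by simp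
  then obtain \<pi> where \<pi>: "\<pi> permutes V" "pairing V (Suc k) (\<lambda>T. w (\<pi> ` T)) u \<noteq> 0"
    using harmonic_translate_pairing_nonzero[OF assms] u(1) by metis
  have "(\<lambda>T. w (\<pi> ` T)) \<in> translates V w" using \<pi>(1) by (auto simp: translates_def)
  from bspec[OF u(2) InrI[OF this]] \<pi>(2) show False by (simp add: pairing_def)
qed

section \<open>Hypergraphs of constant codegree\<close>

definition codegree :: "'a set \<Rightarrow> 'a set set \<Rightarrow> 'a set \<Rightarrow> nat" where
  "codegree V F R = card {z \<in> V - R. insert z R \<in> F}"

lemma codegree_permute:
  assumes "\<pi> permutes V" "\<And>T. \<pi> ` T \<in> F \<longleftrightarrow> T \<in> F"
  shows "codegree V F (\<pi> ` R) = codegree V F R"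
proof -
  have "insert (\<pi> z) (\<pi> ` R) \<in> F \<longleftrightarrow> insert z R \<in> F" for z
    using assms(2)[of "insert z R"] by simp
  then have "{y \<in> \<pi> ` (V - R). insert y (\<pi> ` R) \<in> F} = \<pi> ` {z \<in> V - R. insert z R \<in> F}"
    by auto
  then show ?thesis
    using assms(1) by (simp add: codegree_def permutes_image_Diff card_image permutes_inj_on)
qed

lemma harmonic_of_constant_codegree:
  assumes "finite V" "k < card V" "\<And>R. R \<in> nsets V k \<Longrightarrow> codegree V F R = d"
  shows "harmonic V (Suc k)
    (\<lambda>T. of_bool (T \<in> F) - of_nat d / of_nat (card V - k) :: 'f::field_char_0)"
proof -
  let ?\<mu> = "of_nat d / of_nat (card V - k) :: 'f"
  have "(\<Sum>z\<in>V - R. of_bool (insert z R \<in> F) - ?\<mu>) = 0" if R: "R \<in> nsets V k" for R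
  proof -
    have "card (V - R) = card V - k" using R by (auto simp: nsets_def card_Diff_subset)
    moreover have "(\<Sum>z\<in>V - R. of_bool (insert z R \<in> F)) = (of_nat d :: 'f)"
      using assms(3)[OF R] \<open>finite V\<close> by (simp add: codegree_def Int_def)
    ultimately show ?thesis using assms(2) by (simp add: sum_subtractf)
  qed
  then show ?thesis by simp
qed

section \<open>Actions of a symmetric group\<close>

locale symmetric_action =
  fixes V :: "'a set" and act :: "('a \<Rightarrow> 'a) \<Rightarrow> 'o \<Rightarrow> 'o"
  assumes finite_V: "finite V"
    and act_id: "act id x = x"
    and act_comp: "\<sigma> permutes V \<Longrightarrow> \<pi> permutes V \<Longrightarrow> act (\<sigma> \<circ> \<pi>) x = act \<sigma> (act \<pi> x)"
begin

definition orbit :: "'o \<Rightarrow> 'o set" where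
  "orbit x = (\<lambda>\<pi>. act \<pi> x) ` {\<pi>. \<pi> permutes V}"

definition stabilizer :: "'o \<Rightarrow> ('a \<Rightarrow> 'a) set" where
  "stabilizer x = {\<pi>. \<pi> permutes V \<and> act \<pi> x = x}"

definition invariant_family :: "'o \<Rightarrow> 'a set set \<Rightarrow> bool" where
  "invariant_family x F \<longleftrightarrow> (\<forall>u\<in>stabilizer x. \<forall>T. u ` T \<in> F \<longleftrightarrow> T \<in> F)"

definition homogeneous :: "'o \<Rightarrow> nat \<Rightarrow> bool" where
  "homogeneous x k \<longleftrightarrow> (\<forall>S\<in>nsets V k. \<forall>S'\<in>nsets V k. \<exists>u\<in>stabilizer x. u ` S = S')"

lemma finite_orbit: "finite (orbit x)"
  by (simp add: orbit_def finite_V finite_permutations)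

lemma act_in_orbit: "\<pi> permutes V \<Longrightarrow> act \<pi> x \<in> orbit x"
  by (simp add: orbit_def)

lemma self_in_orbit: "x \<in> orbit x"
  using act_in_orbit[OF permutes_id] by (simp add: act_id)

lemma orbit_eq:
  assumes "y \<in> orbit x"
  shows "orbit y = orbit x"
proof -
  obtain \<pi> where \<pi>: "\<pi> permutes V" "y = act \<pi> x" using assms by (auto simp: orbit_def)
  have orbit_act: "orbit (act \<sigma> z) \<subseteq> orbit z" if "\<sigma> permutes V" for \<sigma> z
    using that by (auto simp: orbit_def simp flip: act_comp intro: permutes_compose)
  have "act (inv \<pi>) y = x"
    using \<pi> by (simp add: permutes_inv permutes_inv_o act_id flip: act_comp)
  with orbit_act[OF \<pi>(1), of x] orbit_act[OF permutes_inv[OF \<pi>(1)], of y] \<pi>(2)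
  show ?thesis by simp
qed

lemma stabilizer_permutes: "u \<in> stabilizer x \<Longrightarrow> u permutes V"
  by (simp add: stabilizer_def)

lemma id_in_stabilizer: "id \<in> stabilizer x"
  by (simp add: stabilizer_def permutes_id act_id)

lemma stabilizer_comp: "u \<in> stabilizer x \<Longrightarrow> u' \<in> stabilizer x \<Longrightarrow> u \<circ> u' \<in> stabilizer x"
  by (simp add: stabilizer_def permutes_compose act_comp)

lemma inv_comp_in_stabilizer:
  assumes "\<pi> permutes V" "\<pi>' permutes V" "act \<pi> x = act \<pi>' x"
  shows "inv \<pi> \<circ> \<pi>' \<in> stabilizer x"
proof -
  have "act (inv \<pi> \<circ> \<pi>') x = act (inv \<pi> \<circ> \<pi>) x"
    using assms by (simp add: act_comp permutes_inv)
  with assms show ?thesis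
    by (simp add: stabilizer_def permutes_inv_o permutes_compose permutes_inv act_id)
qed

lemma stabilizer_inv: "u \<in> stabilizer x \<Longrightarrow> inv u \<in> stabilizer x"
  using inv_comp_in_stabilizer[of u id x] by (simp add: stabilizer_def permutes_id act_id)

lemma card_image_le_card_orbit:
  assumes "\<And>\<pi> u. \<pi> permutes V \<Longrightarrow> u \<in> stabilizer x \<Longrightarrow> f (\<pi> \<circ> u) = f \<pi>"
  shows "card (f ` {\<pi>. \<pi> permutes V}) \<le> card (orbit x)"
proof -
  define rep where "rep = inv_into {\<pi>. \<pi> permutes V} (\<lambda>\<pi>. act \<pi> x)"
  have "f \<pi> = f (rep (act \<pi> x))" if "\<pi> permutes V" for \<pi>
  proof -
    have image: "act \<pi> x \<in> (\<lambda>\<pi>. act \<pi> x) ` {\<pi>. \<pi> permutes V}" using that by blast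
    have "rep (act \<pi> x) permutes V" "act (rep (act \<pi> x)) x = act \<pi> x"
      using inv_into_into[OF image] f_inv_into_f[OF image] unfolding rep_def by auto
    then have "f (\<pi> \<circ> (inv \<pi> \<circ> rep (act \<pi> x))) = f \<pi>"
      using assms that inv_comp_in_stabilizer by simp
    then show ?thesis by (simp add: o_assoc permutes_inv_o(1)[OF that])
  qed
  then have "f ` {\<pi>. \<pi> permutes V} \<subseteq> (f \<circ> rep) ` orbit x"
    by (auto simp: orbit_def)
  then show ?thesis using surj_card_le[OF finite_orbit] by blast
qed

lemma binomial_le_card_orbit_of_invariant_set:
  assumes "T \<subseteq> V" "\<And>u. u \<in> stabilizer x \<Longrightarrow> u ` T = T"
  shows "card V choose card T \<le> card (orbit x)"
proof -
  have T: "T \<in> nsets V (card T)"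
    using assms(1) finite_V by (simp add: nsets_def finite_subset)
  have "nsets V (card T) \<subseteq> (\<lambda>\<pi>. \<pi> ` T) ` {\<pi>. \<pi> permutes V}"
    using permutation_between_nsets[OF finite_V T] by blast
  then have "card (nsets V (card T)) \<le> card ((\<lambda>\<pi>. \<pi> ` T) ` {\<pi>. \<pi> permutes V})"
    by (intro card_mono) (simp_all add: finite_V finite_permutations)
  also have "\<dots> \<le> card (orbit x)"
  proof (rule card_image_le_card_orbit)
    show "(\<pi> \<circ> u) ` T = \<pi> ` T" if "u \<in> stabilizer x" for \<pi> u
      using assms(2)[OF that] by (metis image_comp)
  qed
  finally show ?thesis by simp
qed

lemma card_translates_le_card_orbit:
  assumes "\<And>u T. u \<in> stabilizer x \<Longrightarrow> w (u ` T) = w T"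
  shows "card (translates V w) \<le> card (orbit x)"
proof -
  have "translates V w = (\<lambda>\<pi> T. w (inv \<pi> ` T)) ` {\<pi>. \<pi> permutes V}"
    unfolding translates_def by (subst image_inverse_permutations[symmetric]) auto
  also have "card \<dots> \<le> card (orbit x)"
  proof (rule card_image_le_card_orbit)
    fix \<pi> u assume \<pi>: "\<pi> permutes V" and u: "u \<in> stabilizer x"
    have "inv (\<pi> \<circ> u) = inv u \<circ> inv \<pi>"
      using permutes_bij[OF \<pi>] permutes_bij[OF stabilizer_permutes[OF u]] by (rule o_inv_distrib)
    then have "inv (\<pi> \<circ> u) ` T = inv u ` inv \<pi> ` T" for T
      by (metis image_comp)
    then show "(\<lambda>T. w (inv (\<pi> \<circ> u) ` T)) = (\<lambda>T. w (inv \<pi> ` T))"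
      using assms[OF stabilizer_inv[OF u]] by simp
  qed
  finally show ?thesis .
qed

lemma homogeneousE:
  assumes "homogeneous x k" "S \<in> nsets V k" "S' \<in> nsets V k"
  obtains u where "u \<in> stabilizer x" "u ` S = S'"
  using assms unfolding homogeneous_def by blast

lemma harmonic_of_invariant_family:
  assumes "homogeneous x k" "k < card V" "invariant_family x F"
  obtains \<mu> where "harmonic V (Suc k) (\<lambda>T. of_bool (T \<in> F) - \<mu> :: 'f::field_char_0)"
proof -
  obtain R0 where R0: "R0 \<in> nsets V k"
    using assms(2) nsets_eq_empty_iff[of V k] by auto
  have "codegree V F R = codegree V F R0" if R: "R \<in> nsets V k" for R
  proof -
    obtain u where u: "u \<in> stabilizer x" "u ` R0 = R"
      using assms(1) R0 R by (rule homogeneousE)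
    show ?thesis
      using codegree_permute[OF stabilizer_permutes[OF u(1)], of F R0] assms(3) u
      by (simp add: invariant_family_def)
  qed
  from harmonic_of_constant_codegree[OF finite_V assms(2) this] show thesis by (rule that)
qed

lemma invariant_family_of_inhomogeneous:
  assumes "\<not> homogeneous x k"
  obtains F S S' where "S \<in> nsets V k" "S \<in> F" "S' \<in> nsets V k" "S' \<notin> F"
    "invariant_family x F"
proof -
  obtain S S' where S: "S \<in> nsets V k" "S' \<in> nsets V k" "\<And>u. u \<in> stabilizer x \<Longrightarrow> u ` S \<noteq> S'"
    using assms unfolding homogeneous_def by blast
  define F where "F = (\<lambda>u. u ` S) ` stabilizer x"
  have closed: "v ` T \<in> F" if v: "v \<in> stabilizer x" and T: "T \<in> F" for v T
  proof -
    obtain u where u: "u \<in> stabilizer x" "T = u ` S" using T by (auto simp: F_def)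
    then have "v ` T = (v \<circ> u) ` S" by (simp add: image_comp)
    then show ?thesis
      unfolding F_def using stabilizer_comp[OF v u(1)] by (rule image_eqI)
  qed
  have "u ` T \<in> F \<longleftrightarrow> T \<in> F" if "u \<in> stabilizer x" for u T
    using closed[OF that] closed[OF stabilizer_inv[OF that], of "u ` T"]
      image_inv_image_permutes[OF stabilizer_permutes[OF that]] by auto
  then have "invariant_family x F" by (simp add: invariant_family_def)
  moreover have "S \<in> F"
    unfolding F_def using id_in_stabilizer by (rule rev_image_eqI) simp
  moreover have "S' \<notin> F" using S(3) by (auto simp: F_def)
  ultimately show thesis using S(1,2) that by blast
qed

lemma binomial_le_card_orbit_of_inhomogeneous:
  assumes "homogeneous x k" "\<not> homogeneous x (Suc k)"
  shows "card V choose Suc k \<le> (card V choose k) + card (orbit x)"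
proof -
  obtain F S S' where S: "S \<in> nsets V (Suc k)" "S \<in> F" "S' \<in> nsets V (Suc k)" "S' \<notin> F"
    and F: "invariant_family x F"
    using assms(2) by (rule invariant_family_of_inhomogeneous)
  have "k < card V"
    using S(1) card_mono[OF finite_V, of S] by (auto simp: nsets_def)
  then obtain \<mu> :: real where harmonic: "harmonic V (Suc k) (\<lambda>T. of_bool (T \<in> F) - \<mu>)"
    by (rule harmonic_of_invariant_family[OF assms(1) _ F])
  define w where "w = (\<lambda>T. of_bool (T \<in> F) - \<mu>)"
  have "w S \<noteq> 0 \<or> w S' \<noteq> 0" using S(2,4) by (auto simp: w_def)
  then have "card V choose Suc k \<le> (card V choose k) + card (translates V w)"
    using binomial_le_card_harmonic_translates[OF finite_V, of k w] S(1,3) harmonic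
    unfolding w_def by blast
  also have "card (translates V w) \<le> card (orbit x)"
    using F by (intro card_translates_le_card_orbit) (simp add: w_def invariant_family_def)
  finally show ?thesis by simp
qed

lemma homogeneous_0: "homogeneous x 0"
  using id_in_stabilizer by (auto simp: homogeneous_def)

lemma homogeneous_complement:
  assumes "homogeneous x k" "k \<le> card V"
  shows "homogeneous x (card V - k)"
  unfolding homogeneous_def
proof (intro ballI)
  have complement: "V - S \<in> nsets V k" if "S \<in> nsets V (card V - k)" for S
    using that assms(2) finite_V by (auto simp: nsets_def card_Diff_subset)
  fix S S' assume S: "S \<in> nsets V (card V - k)" "S' \<in> nsets V (card V - k)"
  obtain u where u: "u \<in> stabilizer x" "u ` (V - S) = V - S'"
    using assms(1) complement[OF S(1)] complement[OF S(2)] by (rule homogeneousE)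
  then have "V - u ` S = V - S'"
    by (simp add: permutes_image_Diff[OF stabilizer_permutes])
  moreover have "u ` S \<in> nsets V (card V - k)"
    using S(1) image_in_nsets_iff[OF stabilizer_permutes[OF u(1)]] by blast
  ultimately have "u ` S = S'" using S(2) by (auto simp: nsets_def)
  with u(1) show "\<exists>u\<in>stabilizer x. u ` S = S'" by blast
qed

lemma inhomogeneous_le_card: "\<not> homogeneous x k \<Longrightarrow> k \<le> card V"
  using nsets_eq_empty[OF finite_V, of k] by (fastforce simp: homogeneous_def)

lemma least_inhomogeneousE:
  assumes "\<not> homogeneous x k"
  obtains j where "homogeneous x j" "\<not> homogeneous x (Suc j)" "2 * Suc j \<le> card V"
    "{k. \<not> homogeneous x k} \<subseteq> {Suc j..card V - Suc j}"
proof -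
  define m where "m = (LEAST k. \<not> homogeneous x k)"
  have m: "\<not> homogeneous x m" unfolding m_def using assms by (rule LeastI)
  have least: "m \<le> k" if "\<not> homogeneous x k" for k
    unfolding m_def using that by (rule Least_le)
  have upper: "m \<le> card V - k" if "\<not> homogeneous x k" for k
  proof (rule least)
    show "\<not> homogeneous x (card V - k)"
      using that homogeneous_complement[of x "card V - k"] inhomogeneous_le_card[OF that] by auto
  qed
  obtain j where j: "m = Suc j" using m homogeneous_0 by (cases m) auto
  have "homogeneous x j" using least[of j] j by fastforce
  moreover have "2 * Suc j \<le> card V" using upper[OF m] j by simp
  moreover have "{k. \<not> homogeneous x k} \<subseteq> {m..card V - m}"
    using least upper inhomogeneous_le_card by fastforce
  ultimately show thesis using m j that by blast
qed

lemma not_homogeneous_1E: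
  assumes "\<not> homogeneous x 1"
  obtains T where "T \<noteq> {}" "T \<subset> V" "\<And>u. u \<in> stabilizer x \<Longrightarrow> u ` T = T"
proof -
  obtain a b where ab: "a \<in> V" "b \<in> V" "\<And>u. u \<in> stabilizer x \<Longrightarrow> u a \<noteq> b"
    using assms by (auto simp: homogeneous_def nsets_one)
  let ?T = "(\<lambda>u. u a) ` stabilizer x"
  have nonempty: "?T \<noteq> {}" using id_in_stabilizer by (simp add: ex_in_conv[symmetric]) blast
  have "u a \<in> V" if "u \<in> stabilizer x" for u
    using ab(1) permutes_in_image[OF stabilizer_permutes[OF that]] by simp
  then have "?T \<subseteq> V" by (rule image_subsetI)
  moreover have "b \<notin> ?T" using ab(3) by auto
  ultimately have proper: "?T \<subset> V" using ab(2) by auto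
  have "u ` ?T = ?T" if u: "u \<in> stabilizer x" for u
  proof (rule card_subset_eq)
    show "finite ?T" using proper finite_V by (auto intro: finite_subset)
    show "u ` ?T \<subseteq> ?T"
    proof clarify
      fix u' assume "u' \<in> stabilizer x"
      from imageI[OF stabilizer_comp[OF u this], of "\<lambda>u. u a"] show "u (u' a) \<in> ?T" by simp
    qed
    show "card (u ` ?T) = card ?T"
      using stabilizer_permutes[OF u] by (intro card_image permutes_inj_on)
  qed
  with nonempty proper show thesis by (rule that)
qed

lemma symmetric_action_subset: "W \<subseteq> V \<Longrightarrow> symmetric_action W act"
  using finite_V act_id act_comp permutes_subset[of _ W V]
  by (intro symmetric_action.intro) (auto intro: finite_subset)

lemma card_orbit_ge_of_fixed_point:
  assumes "v \<in> V" "\<forall>u\<in>stabilizer x. u v = v"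
  shows "card V * card (symmetric_action.orbit (V - {v}) act x) \<le> card (orbit x)"
proof -
  interpret sub: symmetric_action "V - {v}" act by (rule symmetric_action_subset) blast
  let ?\<tau> = "Transposition.transpose v"
  let ?f = "\<lambda>\<pi>. (\<pi> v, act (?\<tau> (\<pi> v) \<circ> \<pi>) x)"
  have \<tau>: "?\<tau> w permutes V" if "w \<in> V" for w
    using assms(1) that by (rule permutes_swap_id)
  have "V \<times> sub.orbit x \<subseteq> ?f ` {\<pi>. \<pi> permutes V}"
  proof clarify
    fix w y assume w: "w \<in> V" and "y \<in> sub.orbit x"
    then obtain \<rho> where \<rho>: "\<rho> permutes V - {v}" "y = act \<rho> x" by (auto simp: sub.orbit_def)
    have "\<rho> v = v" using \<rho>(1) by (simp add: permutes_not_in)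
    then have "(w, y) = ?f (?\<tau> w \<circ> \<rho>)" by (simp add: \<rho>(2) o_assoc)
    moreover have "?\<tau> w \<circ> \<rho> permutes V"
      using permutes_subset[OF \<rho>(1)] \<tau>[OF w] by (auto intro: permutes_compose)
    ultimately show "(w, y) \<in> ?f ` {\<pi>. \<pi> permutes V}" by blast
  qed
  then have "card (V \<times> sub.orbit x) \<le> card (?f ` {\<pi>. \<pi> permutes V})"
    by (intro card_mono) (simp_all add: finite_V finite_permutations)
  also have "\<dots> \<le> card (orbit x)"
  proof (rule card_image_le_card_orbit)
    fix \<pi> u assume \<pi>: "\<pi> permutes V" and u: "u \<in> stabilizer x"
    have "?\<tau> (\<pi> v) \<circ> \<pi> permutes V"
      using \<pi> \<tau> assms(1) by (simp add: permutes_compose permutes_in_image)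
    then have "act (?\<tau> (\<pi> v) \<circ> \<pi> \<circ> u) x = act (?\<tau> (\<pi> v) \<circ> \<pi>) x"
      using u by (simp add: act_comp[of "?\<tau> (\<pi> v) \<circ> \<pi>" u] stabilizer_def)
    moreover have "u v = v" using u assms(2) by blast
    ultimately show "?f (\<pi> \<circ> u) = ?f \<pi>" by (simp add: o_assoc)
  qed
  finally show ?thesis by (simp add: card_cartesian_product)
qed

lemma transitive_of_fixed_point:
  assumes "v \<in> V" "\<forall>u\<in>stabilizer x. u v = v"
    and "\<And>k. symmetric_action.homogeneous (V - {v}) act x k"
    and "S \<subseteq> V" "S' \<subseteq> V" "card S = card S'" "v \<in> S \<longleftrightarrow> v \<in> S'"
  obtains u where "u \<in> stabilizer x" "u ` S = S'"
proof -
  interpret sub: symmetric_action "V - {v}" act by (rule symmetric_action_subset) blast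
  have "finite S" "finite S'" using assms(4,5) finite_V by (auto intro: finite_subset)
  then have "card (S - {v}) = card (S' - {v})"
    using assms(6,7) by (cases "v \<in> S") auto
  with assms(4,5) \<open>finite S\<close> \<open>finite S'\<close>
  have "S - {v} \<in> nsets (V - {v}) (card (S - {v}))" "S' - {v} \<in> nsets (V - {v}) (card (S - {v}))"
    by (auto simp: nsets_def)
  then obtain u where u: "u \<in> sub.stabilizer x" "u ` (S - {v}) = S' - {v}"
    by (rule sub.homogeneousE[OF assms(3)])
  have "u \<in> stabilizer x"
    using u(1) permutes_subset[of u "V - {v}" V] by (auto simp: stabilizer_def sub.stabilizer_def)
  moreover have "u ` S = S'"
  proof (cases "v \<in> S")
    case True
    then have "u ` S = insert (u v) (u ` (S - {v}))" by blast
    with True u(2) assms(7) assms(2) \<open>u \<in> stabilizer x\<close> show ?thesis by auto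
  qed (use u(2) assms(7) in simp)
  ultimately show thesis by (rule that)
qed

end

section \<open>Lower bounds for orbits\<close>

lemma Suc_times_binomial_Suc: "Suc k * (n choose Suc k) = (n - k) * (n choose k)"
  by (simp only: binomial_absorption binomial_absorb_comp)

lemma mult_Suc_le_double_binomial:
  assumes "1 \<le> k" "2 * Suc k \<le> n"
  shows "n * Suc k \<le> 2 * (n choose k)"
  using assms
proof (induction k rule: dec_induct)
  case (step k)
  have "Suc k * (n * Suc (Suc k)) \<le> Suc (Suc k) * (2 * (n choose k))"
    using mult_left_mono[OF step.IH, of "Suc (Suc k)"] step.prems by (simp add: algebra_simps)
  also have "\<dots> \<le> (n - k) * (2 * (n choose k))" using step.prems by (intro mult_right_mono) auto
  also have "\<dots> = Suc k * (2 * (n choose Suc k))"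
    by (metis Suc_times_binomial_Suc mult.left_commute)
  finally show ?case by (simp only: Suc_mult_le_cancel1)
qed simp

lemma binomial_Suc_difference_ge:
  assumes "1 \<le> k" "2 * Suc k \<le> n"
  shows "n * (n - 2 * k - 1) + 2 * (n choose k) \<le> 2 * (n choose Suc k)"
proof -
  define m where "m = n - 2 * k - 1"
  have n: "n - k = m + Suc k" using assms(2) by (simp add: m_def)
  have "Suc k * (n * m + 2 * (n choose k)) = m * (n * Suc k) + Suc k * (2 * (n choose k))"
    by (simp add: algebra_simps)
  also have "\<dots> \<le> m * (2 * (n choose k)) + Suc k * (2 * (n choose k))"
    using mult_Suc_le_double_binomial[OF assms] by (intro add_right_mono mult_left_mono) auto
  also have "\<dots> = 2 * ((n - k) * (n choose k))" by (simp add: n algebra_simps)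
  also have "\<dots> = Suc k * (2 * (n choose Suc k))"
    by (metis Suc_times_binomial_Suc mult.left_commute)
  finally show ?thesis by (simp only: Suc_mult_le_cancel1 m_def)
qed

lemma binomial_mono_within:
  assumes "k \<le> k'" "k + k' \<le> n"
  shows "n choose k \<le> n choose k'"
proof (cases "2 * k' \<le> n")
  case False
  then have "n choose k \<le> n choose (n - k')" using assms by (intro binomial_mono) auto
  then show ?thesis using binomial_symmetric[of k' n] assms by simp
qed (use assms in \<open>auto intro: binomial_mono\<close>)

context symmetric_action
begin

lemma card_orbit_ge_or_fixed_point:
  assumes "\<not> homogeneous x 1"
  shows "card V * (card V - 1) \<le> 2 * card (orbit x) \<or> (\<exists>v\<in>V. \<forall>u\<in>stabilizer x. u v = v)"
proof -
  obtain T where T: "T \<noteq> {}" "T \<subset> V" "\<And>u. u \<in> stabilizer x \<Longrightarrow> u ` T = T"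
    using not_homogeneous_1E[OF assms] by metis
  have fixes_point: "\<exists>v\<in>V. \<forall>u\<in>stabilizer x. u v = v"
    if "S \<subseteq> V" "card S = 1" "\<And>u. u \<in> stabilizer x \<Longrightarrow> u ` S = S" for S
  proof -
    from that(2) obtain v where "S = {v}" by (rule card_1_singletonE)
    with that(1,3) show ?thesis by auto
  qed
  have finT: "finite T" using T(2) finite_V by (auto intro: finite_subset)
  then have "card T \<noteq> 0" "card T < card V" "card (V - T) = card V - card T"
    using T(1,2) finite_V by (auto simp: psubset_card_mono card_Diff_subset)
  then consider (point) "card T = 1" | (copoint) "card (V - T) = 1"
    | (middle) "2 \<le> card T" "2 + card T \<le> card V"
    by linarith
  then show ?thesis
  proof cases
    case point
    then show ?thesis using fixes_point[of T] T by blast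
  next
    case copoint
    moreover have "u ` (V - T) = V - T" if "u \<in> stabilizer x" for u
      using T(3)[OF that] permutes_image_Diff[OF stabilizer_permutes[OF that]] by simp
    ultimately show ?thesis using fixes_point[of "V - T"] by blast
  next
    case middle
    have "card V * (card V - 1) = 2 * (card V choose 2)"
      using Suc_times_binomial_Suc[of 1 "card V"] by (simp add: numeral_2_eq_2 mult.commute)
    also have "\<dots> \<le> 2 * (card V choose card T)"
      using middle by (intro mult_left_mono binomial_mono_within) auto
    also have "\<dots> \<le> 2 * card (orbit x)"
      using T(2,3) by (intro mult_left_mono binomial_le_card_orbit_of_invariant_set) auto
    finally show ?thesis ..
  qed
qed

lemma card_le_double_card_orbit_of_inhomogeneous:
  assumes "\<not> homogeneous x k"
  shows "card V \<le> 2 * card (orbit x)"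
proof -
  obtain j where j: "homogeneous x j" "\<not> homogeneous x (Suc j)" "2 * Suc j \<le> card V"
    using least_inhomogeneousE[OF assms] by metis
  note dimension_bound = binomial_le_card_orbit_of_inhomogeneous[OF j(1,2)]
  show ?thesis
  proof (cases "j = 0")
    case True
    with dimension_bound j(3) show ?thesis by simp
  next
    case False
    have "card V * 1 \<le> card V * (card V - 2 * j - 1)" using j(3) by (intro mult_left_mono) auto
    then show ?thesis using binomial_Suc_difference_ge[OF _ j(3)] False dimension_bound by linarith
  qed
qed

lemma card_orbit_ge_or_homogeneous_off_fixed_point:
  assumes "v \<in> V" "\<forall>u\<in>stabilizer x. u v = v"
  shows "card V * (card V - 1) \<le> 2 * card (orbit x) \<or>
    (\<forall>k. symmetric_action.homogeneous (V - {v}) act x k)"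
proof -
  interpret sub: symmetric_action "V - {v}" act by (rule symmetric_action_subset) blast
  have "card V * (card V - 1) \<le> 2 * card (orbit x)" if "\<not> sub.homogeneous x k" for k
  proof -
    have "card V * (card V - 1) \<le> card V * (2 * card (sub.orbit x))"
      using sub.card_le_double_card_orbit_of_inhomogeneous[OF that] assms(1) finite_V
      by (intro mult_left_mono) (auto simp: card_Diff_singleton)
    also have "\<dots> \<le> 2 * card (orbit x)"
      using card_orbit_ge_of_fixed_point[OF assms] by simp
    finally show ?thesis .
  qed
  then show ?thesis by blast
qed

lemma card_inhomogeneous_le_card_orbit:
  assumes "homogeneous x 1"
  shows "card V * card {k. \<not> homogeneous x k} \<le> 2 * card (orbit x)"
proof (cases "\<exists>k. \<not> homogeneous x k")
  case True
  then obtain j where j: "homogeneous x j" "\<not> homogeneous x (Suc j)" "2 * Suc j \<le> card V"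
    "{k. \<not> homogeneous x k} \<subseteq> {Suc j..card V - Suc j}"
    using least_inhomogeneousE by metis
  have "1 \<le> j" using j(2) assms by (cases j) auto
  have "card {k. \<not> homogeneous x k} \<le> card V - 2 * j - 1"
    using card_mono[OF _ j(4)] j(3) by simp
  then have "card V * card {k. \<not> homogeneous x k} \<le> card V * (card V - 2 * j - 1)"
    by (rule mult_left_mono) simp
  also have "\<dots> \<le> 2 * card (orbit x)"
    using binomial_Suc_difference_ge[OF \<open>1 \<le> j\<close> j(3)]
      binomial_le_card_orbit_of_inhomogeneous[OF j(1,2)] by linarith
  finally show ?thesis .
qed simp

proposition orbit_trichotomy:
  obtains (few_inhomogeneous) "card V * card {k. \<not> homogeneous x k} \<le> 2 * card (orbit x)"
  | (large_orbit) "card V * (card V - 1) \<le> 2 * card (orbit x)"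
  | (fixed_point) v where "v \<in> V" "\<forall>u\<in>stabilizer x. u v = v" "card V \<le> card (orbit x)"
      "\<forall>k. symmetric_action.homogeneous (V - {v}) act x k"
proof (cases "homogeneous x 1")
  case True
  then show thesis by (intro few_inhomogeneous card_inhomogeneous_le_card_orbit)
next
  case False
  then consider (large) "card V * (card V - 1) \<le> 2 * card (orbit x)"
    | (fixed) v where "v \<in> V" "\<forall>u\<in>stabilizer x. u v = v"
    using card_orbit_ge_or_fixed_point by blast
  then show thesis
  proof cases
    case (fixed v)
    then have "card V choose 1 \<le> card (orbit x)"
      using binomial_le_card_orbit_of_invariant_set[of "{v}" x] by simp
    then show thesis
      using card_orbit_ge_or_homogeneous_off_fixed_point[OF fixed] fixed large_orbit fixed_point
      by auto
  qed (rule large_orbit)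
qed

lemma disjoint_orbits: "pairwise disjnt (orbit ` F)"
  by (auto simp: pairwise_def disjnt_iff) (metis orbit_eq)+

lemma card_UN_le_of_orbits:
  assumes "finite F" and closed: "\<And>x \<pi>. x \<in> F \<Longrightarrow> \<pi> permutes V \<Longrightarrow> act \<pi> x \<in> F"
    and invariant: "\<And>x \<pi>. x \<in> F \<Longrightarrow> \<pi> permutes V \<Longrightarrow> D (act \<pi> x) \<subseteq> D x"
    and bound: "\<And>x. x \<in> F \<Longrightarrow> m * card (D x) \<le> c * card (orbit x)"
  shows "m * card (\<Union>x\<in>F. D x) \<le> c * card F"
proof -
  have F: "F = \<Union>(orbit ` F)"
    using closed self_in_orbit by (auto simp: orbit_def)
  have D: "(\<Union>y\<in>orbit x. D y) = D x" if "x \<in> F" for x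
    using invariant[OF that] self_in_orbit[of x] by (auto simp: orbit_def)
  have "m * card (\<Union>x\<in>F. D x) = m * card (\<Union>C\<in>orbit ` F. \<Union>y\<in>C. D y)"
    by (subst F) simp
  also have "\<dots> \<le> (\<Sum>C\<in>orbit ` F. m * card (\<Union>y\<in>C. D y))"
    unfolding sum_distrib_left[symmetric] using \<open>finite F\<close> by (intro mult_left_mono card_UN_le) auto
  also have "\<dots> \<le> (\<Sum>C\<in>orbit ` F. c * card C)"
    using bound D by (intro sum_mono) auto
  also have "\<dots> = c * card (\<Union>(orbit ` F))"
    using finite_orbit by (subst card_Union_disjoint) (auto simp: disjoint_orbits sum_distrib_left)
  finally show ?thesis by (simp flip: F)
qed

end

section \<open>Labelings and separated ranks\<close>

definition labelings :: "('v::finite \<Rightarrow> nat) set" where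
  "labelings = {x. bij_betw x UNIV {1..CARD('v)}}"

lemma labelings_inj: "x \<in> labelings \<Longrightarrow> inj x"
  by (auto simp: labelings_def bij_betw_def)

lemma labelings_range:
  fixes x :: "'v::finite \<Rightarrow> nat"
  shows "x \<in> labelings \<Longrightarrow> range x = {1..CARD('v)}"
  by (auto simp: labelings_def bij_betw_def)

lemma labelings_ge_1:
  fixes x :: "'v::finite \<Rightarrow> nat"
  shows "x \<in> labelings \<Longrightarrow> 1 \<le> x v"
  using labelings_range[of x] rangeI[of x v] by simp

lemma finite_labelings: "finite (labelings :: ('v::finite \<Rightarrow> nat) set)"
proof (rule finite_subset)
  show "labelings \<subseteq> Pi\<^sub>E (UNIV :: 'v set) (\<lambda>_. {1..CARD('v)})"
    using labelings_range by (fastforce simp: PiE_UNIV_domain)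
qed (intro finite_PiE; simp)

lemma labelings_comp: "x \<in> labelings \<Longrightarrow> \<pi> permutes UNIV \<Longrightarrow> x \<circ> \<pi> \<in> labelings"
  by (auto simp: labelings_def intro: bij_betw_trans permutes_imp_bij)

lemma labelings_comp_iff:
  assumes "\<pi> permutes UNIV"
  shows "x \<circ> \<pi> \<in> labelings \<longleftrightarrow> x \<in> labelings"
  using labelings_comp[OF _ assms, of x] labelings_comp[OF _ permutes_inv[OF assms], of "x \<circ> \<pi>"]
  by (auto simp: comp_assoc permutes_inv_o(1)[OF assms])

lemma labelings_lower_set:
  fixes x :: "'v::finite \<Rightarrow> nat"
  assumes "x \<in> labelings" "j \<le> CARD('v)"
  shows "x ` (x -` {1..j}) = {1..j}" "card (x -` {1..j}) = j"
proof -
  show image: "x ` (x -` {1..j}) = {1..j}"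
    using assms(2) labelings_range[OF assms(1)] by (auto simp: image_vimage_eq)
  have "card (x ` (x -` {1..j})) = card (x -` {1..j})"
    using labelings_inj[OF assms(1)] by (intro card_image) (auto intro: inj_on_subset)
  then show "card (x -` {1..j}) = j" unfolding image by simp
qed

definition translate :: "('v \<Rightarrow> 'v) \<Rightarrow> (('v \<Rightarrow> 'l) \<Rightarrow> 'b) \<Rightarrow> ('v \<Rightarrow> 'l) \<Rightarrow> 'b" where
  "translate \<pi> g = (\<lambda>x. g (x \<circ> \<pi>))"

interpretation translation:
  symmetric_action "UNIV :: 'v::finite set" "translate :: _ \<Rightarrow> (('v \<Rightarrow> 'l) \<Rightarrow> 'b) \<Rightarrow> _"
  by unfold_locales (simp_all add: translate_def comp_assoc)

text \<open>The labelings \<open>y\<close> with \<open>y ` S = {1..j}\<close> are the vertices of a facet of the permutahedron, and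
  \<open>x\<close> is a vertex off that facet for which the facet inequality has slack one.\<close>

definition separates :: "(('v::finite \<Rightarrow> nat) \<Rightarrow> 'b::zero) \<Rightarrow> nat \<Rightarrow> 'v set \<Rightarrow> ('v \<Rightarrow> nat) \<Rightarrow> bool" where
  "separates g j S x \<longleftrightarrow> card S = j \<and> (\<forall>y\<in>labelings. y ` S = {1..j} \<longrightarrow> g y = 0) \<and>
     x \<in> labelings \<and> x ` S = insert (Suc j) {1..<j} \<and> g x \<noteq> 0"

definition separated_ranks :: "(('v::finite \<Rightarrow> nat) \<Rightarrow> 'b::zero) \<Rightarrow> nat set" where
  "separated_ranks g = {j \<in> {1..<CARD('v)}. \<exists>S x. separates g j S x}"

lemma separated_ranks_translate:
  assumes \<pi>: "\<pi> permutes UNIV"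
  shows "separated_ranks (translate \<pi> g) \<subseteq> separated_ranks g"
proof -
  have "separates g j (inv \<pi> ` S) (x \<circ> \<pi>)" if sep: "separates (translate \<pi> g) j S x" for j S x
  proof -
    have "g y = 0" if "y \<in> labelings" "y ` inv \<pi> ` S = {1..j}" for y
    proof -
      have "translate \<pi> g (y \<circ> inv \<pi>) = 0"
        using sep that \<pi> by (simp add: separates_def labelings_comp permutes_inv image_comp)
      then show ?thesis by (simp add: translate_def comp_assoc permutes_inv_o(2)[OF \<pi>])
    qed
    moreover have "(x \<circ> \<pi>) ` inv \<pi> ` S = x ` S"
      by (metis \<pi> image_comp image_image_inv_permutes)
    ultimately show ?thesis
      using sep \<pi> permutes_inv[OF \<pi>]
      by (simp add: separates_def translate_def labelings_comp card_image permutes_inj_on)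
  qed
  then show ?thesis unfolding separated_ranks_def by blast
qed

lemma separates_vanishes_on_translate:
  assumes "separates g j S x" "u \<in> translation.stabilizer g" "y \<in> labelings" "y ` u ` S = {1..j}"
  shows "g y = 0"
proof -
  have u: "u permutes UNIV" "translate u g = g"
    using assms(2) by (simp_all add: translation.stabilizer_def)
  have "y \<circ> u \<in> labelings" "(y \<circ> u) ` S = {1..j}"
    using assms(3,4) u(1) by (simp_all add: labelings_comp image_comp)
  with assms(1) have "g (y \<circ> u) = 0" by (simp add: separates_def)
  with fun_cong[OF u(2), of y] show ?thesis by (simp add: translate_def)
qed

lemma separated_ranks_inhomogeneous:
  fixes g :: "('v::finite \<Rightarrow> nat) \<Rightarrow> 'b::zero"
  assumes "j \<in> separated_ranks g"
  shows "\<not> translation.homogeneous g j"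
proof
  assume hom: "translation.homogeneous g j"
  obtain S x where sep: "separates g j S x" and j: "j \<le> CARD('v)"
    using assms by (auto simp: separated_ranks_def)
  then have S: "card S = j" and x: "x \<in> labelings" "g x \<noteq> 0" by (auto simp: separates_def)
  have "S \<in> nsets UNIV j" "x -` {1..j} \<in> nsets UNIV j"
    using S labelings_lower_set(2)[OF x(1) j] by (auto simp: nsets_def)
  then obtain u where "u \<in> translation.stabilizer g" "u ` S = x -` {1..j}"
    by (rule translation.homogeneousE[OF hom])
  then have "g x = 0"
    using separates_vanishes_on_translate[OF sep _ x(1)] labelings_lower_set(1)[OF x(1) j] by simp
  with x(2) show False ..
qed

definition support_labels :: "(('v::finite \<Rightarrow> nat) \<Rightarrow> 'b::zero) \<Rightarrow> 'v \<Rightarrow> nat set" where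
  "support_labels g v = {y v |y. y \<in> labelings \<and> g y \<noteq> 0}"

lemma finite_support_labels: "finite (support_labels g v)"
  by (rule finite_subset[of _ "(\<lambda>y. y v) ` labelings"])
    (auto simp: support_labels_def finite_labelings)

lemma separates_vanishes_of_fixed_point:
  fixes g :: "('v::finite \<Rightarrow> nat) \<Rightarrow> 'b::zero"
  assumes "\<forall>u\<in>translation.stabilizer g. u v = v"
    and "\<And>k. symmetric_action.homogeneous (UNIV - {v}) translate g k"
    and sep: "separates g j S x" and j: "j \<le> CARD('v)"
    and y: "y \<in> labelings" "v \<in> S \<longleftrightarrow> y v \<le> j"
  shows "g y = 0"
proof -
  have "card S = card (y -` {1..j})" "v \<in> S \<longleftrightarrow> v \<in> y -` {1..j}"
    using labelings_lower_set(2)[OF y(1) j] sep labelings_ge_1[OF y(1)] y(2)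
    by (auto simp: separates_def)
  then obtain u where "u \<in> translation.stabilizer g" "u ` S = y -` {1..j}"
    by (rule translation.transitive_of_fixed_point[OF UNIV_I assms(1,2) subset_UNIV subset_UNIV])
  then show ?thesis
    using separates_vanishes_on_translate[OF sep _ y(1)] labelings_lower_set(1)[OF y(1) j] by simp
qed

lemma separated_rank_of_fixed_point:
  fixes g :: "('v::finite \<Rightarrow> nat) \<Rightarrow> 'b::zero"
  assumes "\<forall>u\<in>translation.stabilizer g. u v = v"
    and "\<And>k. symmetric_action.homogeneous (UNIV - {v}) translate g k"
    and "j \<in> separated_ranks g"
  shows "j = Min (support_labels g v) - 1 \<or> j = Max (support_labels g v)"
proof -
  obtain S x where sep: "separates g j S x" and j: "j \<le> CARD('v)"
    using assms(3) by (auto simp: separated_ranks_def)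
  then have x: "x \<in> labelings" "x ` S = insert (Suc j) {1..<j}" "g x \<noteq> 0"
    by (auto simp: separates_def)
  note vanishes = separates_vanishes_of_fixed_point[OF assms(1,2) sep j]
  have x_v: "x v \<in> support_labels g v" using x(1,3) by (auto simp: support_labels_def)
  have mem: "x v \<in> x ` S \<longleftrightarrow> v \<in> S"
    using labelings_inj[OF x(1)] by (rule inj_image_mem_iff)
  show ?thesis
  proof (cases "v \<in> S")
    case True
    then have "x v = Suc j" using vanishes[OF x(1)] x(2,3) mem by auto
    moreover have "Suc j \<le> l" if "l \<in> support_labels g v" for l
      using that vanishes True by (auto simp: support_labels_def not_less_eq_eq[symmetric])
    ultimately have "Min (support_labels g v) = Suc j"
      using x_v by (intro Min_eqI finite_support_labels) auto
    then show ?thesis by simp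
  next
    case False
    then have "x v = j" using vanishes[OF x(1)] x(2,3) mem labelings_ge_1[OF x(1), of v] by auto
    moreover have "l \<le> j" if "l \<in> support_labels g v" for l
      using that vanishes False by (auto simp: support_labels_def)
    ultimately have "Max (support_labels g v) = j"
      using x_v by (intro Max_eqI finite_support_labels) auto
    then show ?thesis by simp
  qed
qed

lemma card_separated_ranks_le_card_orbit:
  fixes g :: "('v::finite \<Rightarrow> nat) \<Rightarrow> 'b::zero"
  shows "CARD('v) * card (separated_ranks g) \<le> 2 * card (translation.orbit g) \<or>
    CARD('v) * (CARD('v) - 1) \<le> 2 * card (translation.orbit g)"
proof (cases rule: translation.orbit_trichotomy[of g])
  case few_inhomogeneous
  have "finite {k. \<not> translation.homogeneous g k}"
    using translation.inhomogeneous_le_card by (auto simp: finite_nat_set_iff_bounded_le)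
  then have "card (separated_ranks g) \<le> card {k. \<not> translation.homogeneous g k}"
    using separated_ranks_inhomogeneous by (intro card_mono) auto
  then have "CARD('v) * card (separated_ranks g) \<le>
      CARD('v) * card {k. \<not> translation.homogeneous g k}"
    by (rule mult_left_mono) simp
  with few_inhomogeneous show ?thesis by linarith
next
  case (fixed_point v)
  let ?M = "{Min (support_labels g v) - 1, Max (support_labels g v)}"
  have "separated_ranks g \<subseteq> ?M"
    using separated_rank_of_fixed_point[OF fixed_point(2)] fixed_point(4) by blast
  then have "card (separated_ranks g) \<le> card ?M" by (intro card_mono) auto
  also have "\<dots> \<le> 2" by (simp add: card_insert_if)
  finally have "card (separated_ranks g) \<le> 2" .
  then have "CARD('v) * card (separated_ranks g) \<le> CARD('v) * 2" by (rule mult_left_mono) simp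
  with fixed_point(3) show ?thesis by linarith
qed simp

section \<open>Facets of the permutahedron\<close>

definition vertex :: "('n \<Rightarrow> nat) \<Rightarrow> real^'n::finite" where
  "vertex x = (\<chi> v. real (x v))"

lemma perm_vertices_eq: "perm_vertices = vertex ` labelings"
  by (auto simp: perm_vertices_def labelings_def vertex_def vec_eq_iff image_iff)

lemma perm_act_vertex: "perm_act \<pi> (vertex x) = vertex (x \<circ> inv \<pi>)"
  by (simp add: perm_act_def vertex_def vec_eq_iff)

lemma sum_vertex:
  assumes "x \<in> labelings"
  shows "(\<Sum>v\<in>S. vertex x $ v) = real (\<Sum>(x ` S))"
  using inj_on_subset[OF labelings_inj[OF assms], of S] by (simp add: vertex_def sum.reindex)

lemma linear_sum_coordinates: "linear (\<lambda>z::real^'n. \<Sum>v\<in>S. z $ v)"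
  by (simp add: linear_iff sum.distrib sum_distrib_left)

lemma permutahedron_facet_ineq:
  assumes "z \<in> permutahedron"
  shows "real (\<Sum>{1..card S}) \<le> (\<Sum>v\<in>S. z $ v)"
proof -
  let ?H = "(\<lambda>z::real^'a. \<Sum>v\<in>S. z $ v) -` {real (\<Sum>{1..card S})..}"
  have "vertex x \<in> ?H" if x: "x \<in> labelings" for x
  proof -
    have "card (x ` S) = card S"
      using inj_on_subset[OF labelings_inj[OF x], of S] by (intro card_image) auto
    moreover have "0 \<notin> x ` S" using labelings_ge_1[OF x] by (metis imageE not_one_le_zero)
    ultimately have "card (insert 0 (x ` S)) = Suc (card S)" by simp
    then have "\<Sum>{0..<Suc (card S)} \<le> \<Sum>(x ` S)"
      using card_sum_le_nat_sum[of "insert 0 (x ` S)"] \<open>0 \<notin> x ` S\<close> by simp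
    moreover have "\<Sum>{0..<Suc (card S)} = \<Sum>{1..card S}"
      by (rule sum.mono_neutral_right) auto
    ultimately show ?thesis by (simp add: sum_vertex[OF x] del: of_nat_sum)
  qed
  then have "perm_vertices \<subseteq> ?H" by (auto simp: perm_vertices_eq)
  moreover have "convex ?H"
    by (intro convex_linear_vimage linear_sum_coordinates convex_real_interval)
  ultimately show ?thesis
    using assms hull_minimal[of perm_vertices ?H convex] by (auto simp: permutahedron_def)
qed

lemma exists_labelings_adjacent_to_facet:
  assumes "1 \<le> j" "j < CARD('n)"
  obtains S :: "'n::finite set" and y x where "card S = j" "y \<in> labelings" "y ` S = {1..j}"
    "x \<in> labelings" "x ` S = insert (Suc j) {1..<j}"
proof -
  obtain y :: "'n \<Rightarrow> nat" where y: "y \<in> labelings"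
    using finite_same_card_bij[of "UNIV :: 'n set" "{1..CARD('n)}"] by (auto simp: labelings_def)
  let ?\<tau> = "Transposition.transpose j (Suc j)" and ?S = "y -` {1..j}"
  have "?\<tau> permutes {1..CARD('n)}" using assms by (intro permutes_swap_id) auto
  then have "?\<tau> \<circ> y \<in> labelings"
    using y bij_betw_trans permutes_imp_bij unfolding labelings_def by blast
  moreover have "(?\<tau> \<circ> y) ` ?S = insert (Suc j) {1..<j}"
  proof -
    have "(?\<tau> \<circ> y) ` ?S = ?\<tau> ` {1..j}"
      using labelings_lower_set(1)[OF y, of j] assms(2) by (metis image_comp less_imp_le)
    also have "\<dots> = ?\<tau> ` insert j {1..<j}"
      using assms(1) by (intro arg_cong[of _ _ "image ?\<tau>"]) auto
    also have "\<dots> = insert (Suc j) {1..<j}" by simp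
    finally show ?thesis .
  qed
  ultimately show thesis using y labelings_lower_set[OF y, of j] assms(2) that by simp
qed

section \<open>Separating coordinates of an extension\<close>

text \<open>If \<open>h r > h q\<close>, one could decrease \<open>h\<close> by moving from \<open>q\<close> slightly away from \<open>r\<close> without leaving
  \<open>Q\<close>.\<close>

lemma minimizer_eq_on_support:
  fixes h :: "real^'d::finite \<Rightarrow> real"
  assumes "affine A" and Q: "Q = A \<inter> {y. \<forall>i. 0 \<le> y $ i}" and "linear h"
    and "q \<in> Q" and minimal: "\<And>y. y \<in> Q \<Longrightarrow> h q \<le> h y"
    and "r \<in> Q" and support: "\<And>l. q $ l = 0 \<Longrightarrow> r $ l = 0"
  shows "h r = h q"
proof -
  define z where "z = (\<lambda>\<epsilon>. (1 + \<epsilon>) *\<^sub>R q + (- \<epsilon>) *\<^sub>R r)"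
  have "\<forall>\<^sub>F \<epsilon> in at_right 0. 0 \<le> z \<epsilon> $ l" for l
  proof (cases "q $ l = 0")
    case False
    have "((\<lambda>\<epsilon>. z \<epsilon> $ l) \<longlongrightarrow> (1 + 0) * q $ l + - 0 * r $ l) (at_right 0)"
      unfolding z_def by (auto intro!: tendsto_eq_intros)
    moreover have "0 < q $ l" using False \<open>q \<in> Q\<close> Q by (simp add: order.strict_iff_order)
    ultimately have "\<forall>\<^sub>F \<epsilon> in at_right 0. 0 < z \<epsilon> $ l" by (intro order_tendstoD(1)) auto
    then show ?thesis by (rule eventually_mono) simp
  qed (use support in \<open>simp add: z_def\<close>)
  then have "\<forall>\<^sub>F \<epsilon> in at_right 0. \<epsilon> > 0 \<and> (\<forall>l. 0 \<le> z \<epsilon> $ l)"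
    by (intro eventually_conj eventually_all_finite eventually_at_right_less)
  then obtain \<epsilon> :: real where \<epsilon>: "\<epsilon> > 0" "\<forall>l. 0 \<le> z \<epsilon> $ l"
    using eventually_happens'[OF trivial_limit_at_right_real] by blast
  have "z \<epsilon> \<in> A"
    unfolding z_def using \<open>q \<in> Q\<close> \<open>r \<in> Q\<close> Q by (intro mem_affine[OF \<open>affine A\<close>]) auto
  with \<epsilon>(2) have "h q \<le> h (z \<epsilon>)" by (intro minimal) (simp add: Q)
  also have "h (z \<epsilon>) = (1 + \<epsilon>) * h q - \<epsilon> * h r"
    using \<open>linear h\<close> by (simp add: z_def linear_add linear_scale linear_diff)
  finally have "\<epsilon> * h r \<le> \<epsilon> * h q" by (simp add: algebra_simps)
  then have "h r \<le> h q" using \<epsilon>(1) by simp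
  with minimal[OF \<open>r \<in> Q\<close>] show ?thesis by simp
qed

lemma minimum_on_joint_support:
  fixes h :: "real^'d::finite \<Rightarrow> real"
  assumes "affine A" and Q: "Q = A \<inter> {y. \<forall>i. 0 \<le> y $ i}" and "linear h"
    and lower: "\<And>y. y \<in> Q \<Longrightarrow> c \<le> h y"
    and L: "finite L" "L \<noteq> {}" "L \<subseteq> Q" "\<And>y. y \<in> L \<Longrightarrow> h y = c"
    and "r \<in> Q" and support: "\<And>l. (\<forall>y\<in>L. y $ l = 0) \<Longrightarrow> r $ l = 0"
  shows "h r = c"
proof -
  define q where "q = (\<Sum>y\<in>L. (1 / card L) *\<^sub>R y)"
  have card: "real (card L) > 0" using L(1,2) by (simp add: card_gt_0_iff)
  have q_nth: "q $ l = (\<Sum>y\<in>L. y $ l) / card L" for l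
    by (simp add: q_def sum_divide_distrib)
  have nonneg: "0 \<le> y $ l" if "y \<in> L" for y l using that L(3) Q by blast
  have "q \<in> A"
    unfolding q_def using L(3) Q card
    by (intro convex_sum[OF L(1) affine_imp_convex[OF \<open>affine A\<close>]]) auto
  moreover have "0 \<le> q $ l" for l using nonneg by (simp add: q_nth sum_nonneg)
  ultimately have "q \<in> Q" by (simp add: Q)
  have "h q = (\<Sum>y\<in>L. 1 / card L * h y)"
    unfolding q_def by (simp add: linear_sum[OF \<open>linear h\<close>] linear_scale[OF \<open>linear h\<close>])
  also have "\<dots> = c" using L(4) card by simp
  finally have "h q = c" .
  moreover have "r $ l = 0" if "q $ l = 0" for l
  proof (rule support)
    have "(\<Sum>y\<in>L. y $ l) = 0" using that card by (simp add: q_nth)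
    then show "\<forall>y\<in>L. y $ l = 0" using L(1) nonneg by (simp add: sum_nonneg_eq_0_iff)
  qed
  ultimately show ?thesis
    using minimizer_eq_on_support[OF assms(1-3) \<open>q \<in> Q\<close> _ \<open>r \<in> Q\<close>] lower by simp
qed

lemma exists_separating_coordinate:
  fixes Q :: "(real^'d::finite) set" and p :: "real^'d \<Rightarrow> real^'n::finite"
  assumes "subspace_extension Q p"
    and lift: "\<And>x. x \<in> labelings \<Longrightarrow> s (vertex x) \<in> Q \<and> p (s (vertex x)) = vertex x"
    and "1 \<le> j" "j < CARD('n)"
  shows "\<exists>l S x. separates (\<lambda>y. s (vertex y) $ l) j S x"
proof (rule ccontr)
  assume not_separated: "\<not> ?thesis"
  obtain A where A: "affine A" "Q = A \<inter> {y. \<forall>i. 0 \<le> y $ i}"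
    and p: "linear p" "p ` Q = permutahedron"
    using assms(1) by (auto simp: subspace_extension_def)
  obtain S :: "'n set" and y\<^sub>0 x where S: "card S = j" and y\<^sub>0: "y\<^sub>0 \<in> labelings" "y\<^sub>0 ` S = {1..j}"
    and x: "x \<in> labelings" "x ` S = insert (Suc j) {1..<j}"
    using exists_labelings_adjacent_to_facet[OF assms(3,4)] by metis
  define h where "h = (\<lambda>z. \<Sum>v\<in>S. p z $ v)"
  define L where "L = (\<lambda>y. s (vertex y)) ` {y \<in> labelings. y ` S = {1..j}}"
  have h_lift: "h (s (vertex y)) = real (\<Sum>(y ` S))" if "y \<in> labelings" for y
    using lift[OF that] sum_vertex[OF that] by (simp add: h_def)
  have "h (s (vertex x)) = real (\<Sum>{1..j})"
  proof (rule minimum_on_joint_support[OF A])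
    show "linear h"
      unfolding h_def using linear_compose[OF p(1) linear_sum_coordinates] by (simp add: comp_def)
    show "real (\<Sum>{1..j}) \<le> h z" if "z \<in> Q" for z
      using that p(2) permutahedron_facet_ineq[of "p z" S] S by (auto simp: h_def)
    show "finite L" by (simp add: L_def finite_labelings)
    show "L \<noteq> {}" using y\<^sub>0 by (auto simp: L_def)
    show "L \<subseteq> Q" using lift by (auto simp: L_def)
    show "h z = real (\<Sum>{1..j})" if "z \<in> L" for z using that h_lift by (auto simp: L_def)
    show "s (vertex x) \<in> Q" using lift[OF x(1)] ..
    show "s (vertex x) $ l = 0" if "\<forall>z\<in>L. z $ l = 0" for l
    proof (rule ccontr)
      assume "s (vertex x) $ l \<noteq> 0"
      with S x that have "separates (\<lambda>y. s (vertex y) $ l) j S x"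
        by (simp add: separates_def L_def)
      with not_separated show False by blast
    qed
  qed
  moreover have "\<Sum>(x ` S) = \<Sum>{1..j} + 1"
    using assms(3) by (simp add: x(2) sum.last_plus)
  ultimately show False using h_lift[OF x(1)] by simp
qed

section \<open>The size of weakly symmetric extensions\<close>

definition coordinate :: "(real^'n \<Rightarrow> real^'d) \<Rightarrow> 'd \<Rightarrow> ('n::finite \<Rightarrow> nat) \<Rightarrow> real" where
  "coordinate s l = (\<lambda>x. if x \<in> labelings then s (vertex x) $ l else 0)"

lemma translate_coordinate:
  assumes "weakly_symmetric_section Q p s" "\<pi> permutes UNIV"
  obtains l' where "translate \<pi> (coordinate s l) = coordinate s l'"
proof -
  obtain \<kappa> where \<kappa>: "\<And>x. x \<in> perm_vertices \<Longrightarrow> s (perm_act (inv \<pi>) x) = perm_act \<kappa> (s x)"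
    using assms(1) permutes_inv[OF assms(2)] unfolding weakly_symmetric_section_def by blast
  have "s (vertex (x \<circ> \<pi>)) $ l = s (vertex x) $ inv \<kappa> l" if "x \<in> labelings" for x
  proof -
    have "s (vertex (x \<circ> \<pi>)) = s (perm_act (inv \<pi>) (vertex x))"
      by (simp add: perm_act_vertex permutes_inv_inv[OF assms(2)])
    also have "\<dots> = perm_act \<kappa> (s (vertex x))"
      using that by (intro \<kappa>) (simp add: perm_vertices_eq)
    finally show ?thesis by (simp add: perm_act_def)
  qed
  then have "translate \<pi> (coordinate s l) = coordinate s (inv \<kappa> l)"
    by (auto simp: fun_eq_iff translate_def coordinate_def labelings_comp_iff[OF assms(2)])
  then show thesis by (rule that)
qed

lemma separated_ranks_coordinates:
  fixes Q :: "(real^'d::finite) set" and p :: "real^'d \<Rightarrow> real^'n::finite"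
  assumes "subspace_extension Q p" "weakly_symmetric_section Q p s"
  shows "(\<Union>g\<in>range (coordinate s). separated_ranks g) = {1..<CARD('n)}"
proof
  show "{1..<CARD('n)} \<subseteq> (\<Union>g\<in>range (coordinate s). separated_ranks g)"
  proof
    fix j assume j: "j \<in> {1..<CARD('n)}"
    then obtain l S x where "separates (\<lambda>y. s (vertex y) $ l) j S x"
      using exists_separating_coordinate[OF assms(1), of s j] assms(2)
      by (auto simp: weakly_symmetric_section_def perm_vertices_eq)
    then have "separates (coordinate s l) j S x" by (auto simp: separates_def coordinate_def)
    with j show "j \<in> (\<Union>g\<in>range (coordinate s). separated_ranks g)"
      by (auto simp: separated_ranks_def)
  qed
qed (auto simp: separated_ranks_def)

theorem weakly_symmetric_extension_size_ge:
  fixes Q :: "(real^'d::finite) set" and p :: "real^'d \<Rightarrow> real^'n::finite"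
  assumes "subspace_extension Q p" "weakly_symmetric_section Q p s"
  shows "CARD('n) * (CARD('n) - 1) \<le> 2 * CARD('d)"
proof (rule ccontr)
  let ?F = "range (coordinate s)"
  assume small: "\<not> ?thesis"
  have card_F: "card ?F \<le> CARD('d)" by (rule card_image_le) simp
  have closed: "translate \<pi> g \<in> ?F" if "g \<in> ?F" "\<pi> permutes UNIV" for g \<pi>
    using that translate_coordinate[OF assms(2) that(2)] by (metis rangeE rangeI)
  have "CARD('n) * card (separated_ranks g) \<le> 2 * card (translation.orbit g)" if g: "g \<in> ?F" for g
  proof -
    have "translation.orbit g \<subseteq> ?F" using closed[OF g] by (auto simp: translation.orbit_def)
    then have "card (translation.orbit g) \<le> CARD('d)"
      using card_mono[of ?F "translation.orbit g"] card_F by simp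
    then show ?thesis
      using card_separated_ranks_le_card_orbit[of g] small by linarith
  qed
  then have "CARD('n) * card (\<Union>g\<in>?F. separated_ranks g) \<le> 2 * card ?F"
    by (intro translation.card_UN_le_of_orbits closed separated_ranks_translate) simp_all
  then have "CARD('n) * (CARD('n) - 1) \<le> 2 * card ?F"
    unfolding separated_ranks_coordinates[OF assms] by simp
  with small card_F show False by linarith
qed

theorem theorem6:
  fixes Q :: "(real^'d::finite) set"
    and p :: "real^'d \<Rightarrow> real^'n::finite"
    and s :: "real^'n \<Rightarrow> real^'d"
  assumes "CARD('n) \<ge> 6"
    and "2 * CARD('d) < CARD('n) * (CARD('n) - 1)"
    and "subspace_extension Q p"
    and "weakly_symmetric_section Q p s"
  shows "\<exists>(k::nat) (m::nat) (a :: nat \<Rightarrow> 'n \<Rightarrow> 'd) (b :: nat \<Rightarrow> 'd).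
           bij_betw (case_sum (\<lambda>(i, t). a i t) b) (({..<k} \<times> (UNIV::'n set)) <+> {..<m}) (UNIV::'d set) \<and>
           (\<forall>x\<in>perm_vertices. \<forall>\<pi>. \<pi> permutes (UNIV::'n set) \<and> evenperm \<pi> \<longrightarrow>
              (\<forall>i<k. \<forall>t. s (perm_act \<pi> x) $ a i t = s x $ a i (inv \<pi> t)) \<and>
              (\<forall>j<m. s (perm_act \<pi> x) $ b j = s x $ b j))"
proof -
  have "CARD('n) * (CARD('n) - 1) \<le> 2 * CARD('d)"
    using assms(3,4) by (rule weakly_symmetric_extension_size_ge)
  with assms(2) show ?thesis by linarith
qed

end
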